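(* Let $A$ be a commutative ring with identity $1 \neq 0$, $E$ a (unital) $A$-module, and let $R = A \propto E$ be the trivial ring extension of $A$ by $E$. Then $R$ is a weak von Neumann regular ring if and only if both of the following statements are true: (1) $A$ is a weak von Neumann regular ring; (2) $aE = 0$ for every idempotent element $a \in A$ with $a \neq 1$.
   Context: All rings are commutative with identity $1\neq 0$ and all modules are unital. A ring $S$ is called a weak von Neumann regular ring (WVNR ring) if for all finitely generated ideals $I$ and $J$ of $S$ with $I \subseteq J \subsetneq S$: whenever $J$ is generated by an idempotent element of $S$, then $I$ is also generated by an idempotent element of $S$. The trivial ring extension (idealization) $A \propto E$ is the set of pairs $(a,e)$ with $a\in A$, $e \in E$, with componentwise addition and multiplication $(a,e)(b,f) = (ab, af + be)$. *)

theory Defs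
  imports "HOL-Algebra.Ideal" "HOL-Algebra.Module"
begin

definition idempotent_element :: "('a, 'm) ring_scheme \<Rightarrow> 'a \<Rightarrow> bool" where
  "idempotent_element S e \<longleftrightarrow> e \<in> carrier S \<and> e \<otimes>\<^bsub>S\<^esub> e = e"

definition finitely_generated_ideal :: "('a, 'm) ring_scheme \<Rightarrow> 'a set \<Rightarrow> bool" where
  "finitely_generated_ideal S I \<longleftrightarrow> (\<exists>X. finite X \<and> X \<subseteq> carrier S \<and> I = Idl\<^bsub>S\<^esub> X)"

definition idempotent_generated :: "('a, 'm) ring_scheme \<Rightarrow> 'a set \<Rightarrow> bool" where
  "idempotent_generated S I \<longleftrightarrow> (\<exists>e. idempotent_element S e \<and> I = Idl\<^bsub>S\<^esub> {e})"

text \<open>The term \<open>ring\<close> means a commutative ring with \<open>1 \<noteq> 0\<close>; this is part of the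
  predicate.\<close>

locale wvnr_ring = cring S for S (structure) +
  assumes one_neq_zero: "\<one> \<noteq> \<zero>"
    and idempotent_generated_subideal:
      "\<lbrakk>finitely_generated_ideal S I; finitely_generated_ideal S J;
        I \<subseteq> J; J \<noteq> carrier S; idempotent_generated S J\<rbrakk> \<Longrightarrow> idempotent_generated S I"

definition trivial_extension ::
    "('a, 'm) ring_scheme \<Rightarrow> ('a, 'b, 'n) module_scheme \<Rightarrow> ('a \<times> 'b) ring" where
  "trivial_extension A E =
    \<lparr>carrier = carrier A \<times> carrier E,
     mult = (\<lambda>(a, e) (b, f). (a \<otimes>\<^bsub>A\<^esub> b, (a \<odot>\<^bsub>E\<^esub> f) \<oplus>\<^bsub>E\<^esub> (b \<odot>\<^bsub>E\<^esub> e))),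
     one = (\<one>\<^bsub>A\<^esub>, \<zero>\<^bsub>E\<^esub>),
     zero = (\<zero>\<^bsub>A\<^esub>, \<zero>\<^bsub>E\<^esub>),
     add = (\<lambda>(a, e) (b, f). (a \<oplus>\<^bsub>A\<^esub> b, e \<oplus>\<^bsub>E\<^esub> f))\<rparr>"

lemma cring_trivial_extension:
  assumes "module A E"
  shows "cring (trivial_extension A E)"
proof -
  interpret module A E by fact
  show ?thesis
  proof (rule cringI)
    show "abelian_group (trivial_extension A E)"
    proof (rule abelian_groupI)
      fix x assume "x \<in> carrier (trivial_extension A E)"
      then have "(\<ominus>\<^bsub>A\<^esub> fst x, \<ominus>\<^bsub>E\<^esub> snd x) \<in> carrier (trivial_extension A E)"
        and "(\<ominus>\<^bsub>A\<^esub> fst x, \<ominus>\<^bsub>E\<^esub> snd x) \<oplus>\<^bsub>trivial_extension A E\<^esub> x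
          = \<zero>\<^bsub>trivial_extension A E\<^esub>"
        by (auto simp: trivial_extension_def R.l_neg M.l_neg)
      then show "\<exists>y\<in>carrier (trivial_extension A E).
          y \<oplus>\<^bsub>trivial_extension A E\<^esub> x = \<zero>\<^bsub>trivial_extension A E\<^esub>" by blast
    qed (auto simp: trivial_extension_def R.a_ac M.a_ac)
    show "comm_monoid (trivial_extension A E)"
    proof (rule comm_monoidI)
      fix x y z
      assume "x \<in> carrier (trivial_extension A E)" "y \<in> carrier (trivial_extension A E)"
        "z \<in> carrier (trivial_extension A E)"
      then show "x \<otimes>\<^bsub>trivial_extension A E\<^esub> y \<otimes>\<^bsub>trivial_extension A E\<^esub> z
          = x \<otimes>\<^bsub>trivial_extension A E\<^esub> (y \<otimes>\<^bsub>trivial_extension A E\<^esub> z)"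
        by (auto simp: trivial_extension_def R.m_ac smult_r_distr M.a_ac
            smult_assoc1[symmetric])
    qed (auto simp: trivial_extension_def R.m_comm M.a_comm)
  qed (auto simp: trivial_extension_def R.l_distr smult_l_distr smult_r_distr M.a_ac)
qed

end

theory Submission
  imports Defs "HOL-Algebra.QuotRing"
begin

text \<open>An idempotent \<open>(a, f)\<close> of the extension has \<open>f = 2af\<close>, so condition (2) forces \<open>f = 0\<close> as
  soon as \<open>a \<noteq> 1\<close>; the proper ideals with an idempotent generator are then the sets \<open>aA \<times> 0\<close>,
  and their subideals are those of \<open>aA\<close>. Conversely, \<open>(0, ae)\<close> lies in the ideal generated by
  \<open>(a, 0)\<close>, while the only idempotent of the form \<open>(0, f)\<close> is zero; this gives condition (2).\<close>

section \<open>Ideals under surjective ring homomorphisms\<close>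

lemma (in ring_hom_ring) image_ideal:
  assumes "ideal I R" and surj: "h ` carrier R = carrier S"
  shows "ideal (h ` I) S"
proof (rule idealI[OF S.ring_axioms])
  interpret I: ideal I R by fact
  show "subgroup (h ` I) (add_monoid S)"
    by (rule img_is_add_subgroup[OF I.a_subgroup])
  fix a x assume "a \<in> h ` I" "x \<in> carrier S"
  \<comment> \<open>Surjectivity enters here: an arbitrary multiplier in \<open>S\<close> must be
    lifted to \<open>R\<close> before absorption in \<open>I\<close> can be used.\<close>
  then obtain b y where b: "b \<in> I" "a = h b" and y: "y \<in> carrier R" "x = h y"
    using surj by blast
  have "x \<otimes>\<^bsub>S\<^esub> a = h (y \<otimes>\<^bsub>R\<^esub> b)" "a \<otimes>\<^bsub>S\<^esub> x = h (b \<otimes>\<^bsub>R\<^esub> y)"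
    using b y by auto
  then show "x \<otimes>\<^bsub>S\<^esub> a \<in> h ` I" "a \<otimes>\<^bsub>S\<^esub> x \<in> h ` I"
    using b(1) y(1) I.I_l_closed I.I_r_closed by blast+
qed

text \<open>Both inclusions are minimality of a generated ideal: the preimage of
  \<open>Idl (h\<close> X)\<open>is an ideal containing\<close>X\<open>, and the image of\<close>Idl
  X\<open>is an ideal containing\<close>h \<open>X\<close>, the latter by surjectivity.\<close>

lemma (in ring_hom_ring) image_genideal:
  assumes surj: "h ` carrier R = carrier S" and X: "X \<subseteq> carrier R"
  shows "h ` (Idl\<^bsub>R\<^esub> X) = Idl\<^bsub>S\<^esub> (h ` X)"
proof
  have hX: "h ` X \<subseteq> carrier S"
    using X by auto
  have "ideal {r \<in> carrier R. h r \<in> Idl\<^bsub>S\<^esub> (h ` X)} R"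
    by (rule ideal_vimage[OF S.genideal_ideal[OF hX]])
  moreover have "X \<subseteq> {r \<in> carrier R. h r \<in> Idl\<^bsub>S\<^esub> (h ` X)}"
    using X S.genideal_self[OF hX] by auto
  ultimately show "h ` (Idl\<^bsub>R\<^esub> X) \<subseteq> Idl\<^bsub>S\<^esub> (h ` X)"
    using R.genideal_minimal by blast
  have "ideal (h ` (Idl\<^bsub>R\<^esub> X)) S"
    using image_ideal[OF R.genideal_ideal[OF X] surj] .
  then show "Idl\<^bsub>S\<^esub> (h ` X) \<subseteq> h ` (Idl\<^bsub>R\<^esub> X)"
    using S.genideal_minimal R.genideal_self[OF X] by blast
qed

section \<open>Principal ideals generated by idempotents\<close>

lemma (in cring) genideal_singleton_iff:
  "a \<in> carrier R \<Longrightarrow> x \<in> Idl {a} \<longleftrightarrow> (\<exists>y \<in> carrier R. x = y \<otimes> a)"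
  by (auto simp: cgenideal_eq_genideal[symmetric] cgenideal_def)

text \<open>An idempotent acts as the identity on its own ideal, since a(ya) = y(aa) = ya.
  Membership in such an ideal thus becomes an equation, which can be transferred between
  rings.\<close>

lemma (in cring) idempotent_element_absorbs:
  assumes "idempotent_element R a" "x \<in> Idl {a}"
  shows "x \<in> carrier R" "a \<otimes> x = x"
proof -
  have a: "a \<in> carrier R" "a \<otimes> a = a"
    using assms(1) by (auto simp: idempotent_element_def)
  obtain y where "y \<in> carrier R" "x = y \<otimes> a"
    using assms(2) genideal_singleton_iff[OF a(1)] by blast
  then show "x \<in> carrier R" "a \<otimes> x = x"
    using a m_lcomm[of a y a] by auto
qed

lemma (in cring) idempotent_genideal_eq_carrier_iff:
  assumes "idempotent_element R a"
  shows "Idl {a} = carrier R \<longleftrightarrow> a = \<one>"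
proof
  assume "Idl {a} = carrier R"
  then show "a = \<one>"
    using idempotent_element_absorbs(2)[OF assms, of \<one>] assms
    by (auto simp: idempotent_element_def)
qed (simp add: genideal_one)

section \<open>The projection of the extension onto its base ring\<close>

context
  fixes A :: "('a, 'm) ring_scheme" and E :: "('a, 'b, 'n) module_scheme"
  assumes mod: "module A E"
begin

interpretation module A E by (rule mod)
interpretation T: cring "trivial_extension A E" by (rule cring_trivial_extension[OF mod])

lemma carrier_trivial_extension:
  "carrier (trivial_extension A E) = carrier A \<times> carrier E"
  by (simp add: trivial_extension_def)

lemma mult_trivial_extension:
  "(a, e) \<otimes>\<^bsub>trivial_extension A E\<^esub> (b, f)
    = (a \<otimes>\<^bsub>A\<^esub> b, (a \<odot>\<^bsub>E\<^esub> f) \<oplus>\<^bsub>E\<^esub> (b \<odot>\<^bsub>E\<^esub> e))"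
  by (simp add: trivial_extension_def)

lemma one_trivial_extension: "\<one>\<^bsub>trivial_extension A E\<^esub> = (\<one>\<^bsub>A\<^esub>, \<zero>\<^bsub>E\<^esub>)"
  by (simp add: trivial_extension_def)

lemma zero_trivial_extension: "\<zero>\<^bsub>trivial_extension A E\<^esub> = (\<zero>\<^bsub>A\<^esub>, \<zero>\<^bsub>E\<^esub>)"
  by (simp add: trivial_extension_def)

lemmas trivial_extension_simps =
  carrier_trivial_extension mult_trivial_extension one_trivial_extension zero_trivial_extension

lemma fst_hom_trivial_extension: "ring_hom_ring (trivial_extension A E) A fst"
proof (rule ring_hom_ringI2[OF T.ring_axioms R.ring_axioms], rule ring_hom_memI)
qed (auto simp: trivial_extension_def)

interpretation fst: ring_hom_ring "trivial_extension A E" A fst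
  by (rule fst_hom_trivial_extension)

text \<open>The projection is onto because a = fst (a, 0). Through this equation both finite
  generation and generation by an idempotent descend to \<open>A\<close>.\<close>

lemma fst_image_genideal:
  "X \<subseteq> carrier A \<times> carrier E \<Longrightarrow> fst ` (Idl\<^bsub>trivial_extension A E\<^esub> X) = Idl\<^bsub>A\<^esub> (fst ` X)"
  by (rule fst.image_genideal) (auto simp: carrier_trivial_extension image_iff)

lemma idempotent_element_trivial_extension_fst:
  "idempotent_element (trivial_extension A E) (a, f) \<Longrightarrow> idempotent_element A a"
  by (auto simp: idempotent_element_def trivial_extension_simps)

lemma idempotent_element_trivial_extension_zero:
  "idempotent_element A a \<Longrightarrow> idempotent_element (trivial_extension A E) (a, \<zero>\<^bsub>E\<^esub>)"
  by (auto simp: idempotent_element_def trivial_extension_simps)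

lemma idempotent_generated_fst_image:
  assumes "idempotent_generated (trivial_extension A E) I"
  shows "idempotent_generated A (fst ` I)"
proof -
  obtain a f where af: "idempotent_element (trivial_extension A E) (a, f)"
    and I: "I = Idl\<^bsub>trivial_extension A E\<^esub> {(a, f)}"
    using assms by (auto simp: idempotent_generated_def)
  have "fst ` I = Idl\<^bsub>A\<^esub> {a}"
    using fst_image_genideal[of "{(a, f)}"] af
    by (simp add: I idempotent_element_def carrier_trivial_extension)
  then show ?thesis
    using idempotent_element_trivial_extension_fst[OF af] by (auto simp: idempotent_generated_def)
qed

lemma finitely_generated_fst_image:
  assumes "finitely_generated_ideal (trivial_extension A E) I"
  shows "finitely_generated_ideal A (fst ` I)"
proof -
  obtain X where X: "finite X" "X \<subseteq> carrier A \<times> carrier E"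
    and I: "I = Idl\<^bsub>trivial_extension A E\<^esub> X"
    using assms by (auto simp: finitely_generated_ideal_def carrier_trivial_extension)
  have "finite (fst ` X)" "fst ` X \<subseteq> carrier A"
    using X by auto
  then show ?thesis
    using fst_image_genideal[OF X(2)] unfolding finitely_generated_ideal_def I by blast
qed

section \<open>Necessity of the two conditions\<close>

lemma idempotent_annihilates_module:
  assumes wvnr: "wvnr_ring (trivial_extension A E)"
    and a: "idempotent_element A a" "a \<noteq> \<one>\<^bsub>A\<^esub>" and e: "e \<in> carrier E"
  shows "a \<odot>\<^bsub>E\<^esub> e = \<zero>\<^bsub>E\<^esub>"
proof -
  let ?T = "trivial_extension A E"
  have aA: "a \<in> carrier A"
    using a(1) by (simp add: idempotent_element_def)
  note idem = idempotent_element_trivial_extension_zero[OF a(1)]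
  have aT: "(a, \<zero>\<^bsub>E\<^esub>) \<in> carrier ?T" and vT: "(\<zero>\<^bsub>A\<^esub>, a \<odot>\<^bsub>E\<^esub> e) \<in> carrier ?T"
    using aA e by (auto simp: carrier_trivial_extension)
  have "(\<zero>\<^bsub>A\<^esub>, a \<odot>\<^bsub>E\<^esub> e) = (\<zero>\<^bsub>A\<^esub>, e) \<otimes>\<^bsub>?T\<^esub> (a, \<zero>\<^bsub>E\<^esub>)"
    using aA e by (simp add: mult_trivial_extension)
  moreover have "(\<zero>\<^bsub>A\<^esub>, e) \<in> carrier ?T"
    using e by (simp add: carrier_trivial_extension)
  ultimately have "(\<zero>\<^bsub>A\<^esub>, a \<odot>\<^bsub>E\<^esub> e) \<in> Idl\<^bsub>?T\<^esub> {(a, \<zero>\<^bsub>E\<^esub>)}"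
    using T.genideal_singleton_iff[OF aT] by blast
  then have sub: "Idl\<^bsub>?T\<^esub> {(\<zero>\<^bsub>A\<^esub>, a \<odot>\<^bsub>E\<^esub> e)} \<subseteq> Idl\<^bsub>?T\<^esub> {(a, \<zero>\<^bsub>E\<^esub>)}"
    using T.genideal_minimal[OF T.genideal_ideal] aT by simp
  have "Idl\<^bsub>?T\<^esub> {(a, \<zero>\<^bsub>E\<^esub>)} \<noteq> carrier ?T"
    using T.idempotent_genideal_eq_carrier_iff[OF idem] a(2) by (simp add: one_trivial_extension)
  moreover have "finitely_generated_ideal ?T (Idl\<^bsub>?T\<^esub> {x})" if "x \<in> carrier ?T" for x
    using that unfolding finitely_generated_ideal_def by blast
  moreover have "idempotent_generated ?T (Idl\<^bsub>?T\<^esub> {(a, \<zero>\<^bsub>E\<^esub>)})"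
    using idem by (auto simp: idempotent_generated_def)
  ultimately have "idempotent_generated ?T (Idl\<^bsub>?T\<^esub> {(\<zero>\<^bsub>A\<^esub>, a \<odot>\<^bsub>E\<^esub> e)})"
    using wvnr_ring.idempotent_generated_subideal[OF wvnr _ _ sub] aT vT by blast
  then obtain b f where bf: "idempotent_element ?T (b, f)"
    and eq: "Idl\<^bsub>?T\<^esub> {(\<zero>\<^bsub>A\<^esub>, a \<odot>\<^bsub>E\<^esub> e)} = Idl\<^bsub>?T\<^esub> {(b, f)}"
    by (auto simp: idempotent_generated_def)
  have bfA: "b \<in> carrier A" "f \<in> carrier E" and bfT: "(b, f) \<in> carrier ?T"
    using bf by (auto simp: idempotent_element_def carrier_trivial_extension)
  \<comment> \<open>Every multiple of (0, ae) has first component 0, so b = 0. Idempotency of (0, f)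
    then reads f = 0f + 0f = 0, and the ideal of (0, ae) is the zero ideal.\<close>
  have "(b, f) \<in> Idl\<^bsub>?T\<^esub> {(\<zero>\<^bsub>A\<^esub>, a \<odot>\<^bsub>E\<^esub> e)}"
    unfolding eq using T.genideal_self'[OF bfT] .
  then have b: "b = \<zero>\<^bsub>A\<^esub>"
    using T.genideal_singleton_iff[OF vT] by (auto simp: trivial_extension_simps)
  with bf bfA have f: "f = \<zero>\<^bsub>E\<^esub>"
    by (auto simp: idempotent_element_def mult_trivial_extension)
  have "(\<zero>\<^bsub>A\<^esub>, a \<odot>\<^bsub>E\<^esub> e) \<in> Idl\<^bsub>?T\<^esub> {\<zero>\<^bsub>?T\<^esub>}"
    using T.genideal_self'[OF vT] unfolding eq b f zero_trivial_extension .
  then show ?thesis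
    unfolding T.genideal_zero by (simp add: zero_trivial_extension)
qed

text \<open>Generators are lifted by x \<mapsto> (x, 0), the hypothesis is applied in the extension,
  and the result is projected back by \<open>fst\<close>. Lifting generators keeps the ideal
  finitely generated; I \<times> E need not be so, and I \<times> 0 need not be an ideal.\<close>

lemma wvnr_ring_base:
  assumes wvnr: "wvnr_ring (trivial_extension A E)"
  shows "wvnr_ring A"
proof (intro wvnr_ring.intro wvnr_ring_axioms.intro)
  let ?T = "trivial_extension A E"
  show "cring A" ..
  show "\<one>\<^bsub>A\<^esub> \<noteq> \<zero>\<^bsub>A\<^esub>"
    using wvnr_ring.one_neq_zero[OF wvnr] by (simp add: trivial_extension_simps)
  fix I J
  assume "finitely_generated_ideal A I" and IJ: "I \<subseteq> J" and J: "J \<noteq> carrier A"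
    and "idempotent_generated A J"
  then obtain X a where X: "finite X" "X \<subseteq> carrier A" "I = Idl\<^bsub>A\<^esub> X"
    and a: "idempotent_element A a" "J = Idl\<^bsub>A\<^esub> {a}"
    by (auto simp: finitely_generated_ideal_def idempotent_generated_def)
  have aA: "a \<in> carrier A"
    using a(1) by (simp add: idempotent_element_def)
  then have aT: "(a, \<zero>\<^bsub>E\<^esub>) \<in> carrier ?T"
    by (simp add: carrier_trivial_extension)
  note idem = idempotent_element_trivial_extension_zero[OF a(1)]
  let ?X = "(\<lambda>x. (x, \<zero>\<^bsub>E\<^esub>)) ` X"
  let ?I = "Idl\<^bsub>?T\<^esub> ?X" and ?J = "Idl\<^bsub>?T\<^esub> {(a, \<zero>\<^bsub>E\<^esub>)}"
  have XT: "?X \<subseteq> carrier ?T"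
    using X(2) by (auto simp: carrier_trivial_extension)
  have "?X \<subseteq> ?J"
  proof clarify
    fix x assume x: "x \<in> X"
    then have "x \<in> J"
      using IJ R.genideal_self[OF X(2)] X(3) by blast
    \<comment> \<open>As \<open>a\<close> fixes x, multiplying (x, 0) by (a, 0) returns (x, 0); this
      lifts the inclusion of the ideals.\<close>
    then have "a \<otimes>\<^bsub>A\<^esub> x = x"
      using R.idempotent_element_absorbs(2) a by blast
    then have "(x, \<zero>\<^bsub>E\<^esub>) = (x, \<zero>\<^bsub>E\<^esub>) \<otimes>\<^bsub>?T\<^esub> (a, \<zero>\<^bsub>E\<^esub>)"
      using x X(2) aA by (auto simp: mult_trivial_extension R.m_comm)
    then show "(x, \<zero>\<^bsub>E\<^esub>) \<in> ?J"
      using T.genideal_singleton_iff[OF aT] XT x by blast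
  qed
  then have "?I \<subseteq> ?J"
    using T.genideal_minimal[OF T.genideal_ideal] aT by simp
  moreover have "finitely_generated_ideal ?T ?I" "finitely_generated_ideal ?T ?J"
    using X(1) XT aT unfolding finitely_generated_ideal_def by blast+
  \<comment> \<open>Properness in either ring amounts to a \<noteq> 1.\<close>
  moreover have "?J \<noteq> carrier ?T"
    using T.idempotent_genideal_eq_carrier_iff[OF idem] J
      R.idempotent_genideal_eq_carrier_iff[OF a(1)] a(2) by (simp add: one_trivial_extension)
  moreover have "idempotent_generated ?T ?J"
    using idem by (auto simp: idempotent_generated_def)
  ultimately have "idempotent_generated ?T ?I"
    using wvnr_ring.idempotent_generated_subideal[OF wvnr] by blast
  then have "idempotent_generated A (fst ` ?I)"
    by (rule idempotent_generated_fst_image)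
  moreover have "fst ` ?I = I"
    using fst_image_genideal[of ?X] XT X(3)
    by (simp add: carrier_trivial_extension image_image)
  ultimately show "idempotent_generated A I"
    by simp
qed

section \<open>Sufficiency of the two conditions\<close>

lemma genideal_annihilating_idempotent:
  assumes a: "a \<in> carrier A" and ann: "\<And>e. e \<in> carrier E \<Longrightarrow> a \<odot>\<^bsub>E\<^esub> e = \<zero>\<^bsub>E\<^esub>"
  shows "Idl\<^bsub>trivial_extension A E\<^esub> {(a, \<zero>\<^bsub>E\<^esub>)} = (Idl\<^bsub>A\<^esub> {a}) \<times> {\<zero>\<^bsub>E\<^esub>}"
proof -
  have aT: "(a, \<zero>\<^bsub>E\<^esub>) \<in> carrier (trivial_extension A E)"
    using a by (simp add: carrier_trivial_extension)
  show ?thesis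
    \<comment> \<open>The multiples are (y, e)(a, 0) = (ya, ae), and ae = 0.\<close>
    using ann by (force simp: T.genideal_singleton_iff[OF aT] R.genideal_singleton_iff[OF a]
        trivial_extension_simps)
qed

lemma wvnr_ring_trivial_extension:
  assumes wvnr: "wvnr_ring A"
    and ann: "\<And>a e. \<lbrakk>idempotent_element A a; a \<noteq> \<one>\<^bsub>A\<^esub>; e \<in> carrier E\<rbrakk> \<Longrightarrow> a \<odot>\<^bsub>E\<^esub> e = \<zero>\<^bsub>E\<^esub>"
  shows "wvnr_ring (trivial_extension A E)"
proof (intro wvnr_ring.intro wvnr_ring_axioms.intro)
  let ?T = "trivial_extension A E"
  show "cring ?T" ..
  show "\<one>\<^bsub>?T\<^esub> \<noteq> \<zero>\<^bsub>?T\<^esub>"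
    using wvnr_ring.one_neq_zero[OF wvnr] by (simp add: trivial_extension_simps)
  fix I J
  assume I: "finitely_generated_ideal ?T I" and J: "finitely_generated_ideal ?T J"
    and IJ: "I \<subseteq> J" and proper: "J \<noteq> carrier ?T" and gen: "idempotent_generated ?T J"
  obtain a f where idem: "idempotent_element ?T (a, f)" and Jeq: "J = Idl\<^bsub>?T\<^esub> {(a, f)}"
    using gen by (auto simp: idempotent_generated_def)
  have aA: "a \<in> carrier A" and fE: "f \<in> carrier E"
    and two: "(a \<odot>\<^bsub>E\<^esub> f) \<oplus>\<^bsub>E\<^esub> (a \<odot>\<^bsub>E\<^esub> f) = f"
    using idem by (auto simp: idempotent_element_def trivial_extension_simps)
  note a = idempotent_element_trivial_extension_fst[OF idem]
  \<comment> \<open>If a = 1, then \<open>two\<close> reads f + f = f, so (a, f) would be the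
    identity and J the whole ring. With a \<noteq> 1, both summands in \<open>two\<close> vanish by
    annihilation, so again f = 0.\<close>
  have a1: "a \<noteq> \<one>\<^bsub>A\<^esub>"
  proof
    assume a1: "a = \<one>\<^bsub>A\<^esub>"
    then have "f = \<zero>\<^bsub>E\<^esub>"
      using two fE by (simp add: M.add.r_cancel_one)
    then show False
      using T.idempotent_genideal_eq_carrier_iff[OF idem] proper Jeq a1
      by (simp add: one_trivial_extension)
  qed
  then have f: "f = \<zero>\<^bsub>E\<^esub>"
    using two ann[OF a a1 fE] by simp
  have Jprod: "J = (Idl\<^bsub>A\<^esub> {a}) \<times> {\<zero>\<^bsub>E\<^esub>}"
    unfolding Jeq f by (rule genideal_annihilating_idempotent[OF aA ann[OF a a1]])
  have fstJ: "fst ` J = Idl\<^bsub>A\<^esub> {a}"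
    by (auto simp: Jprod image_iff)
  have fst_proper: "fst ` J \<noteq> carrier A"
    using R.idempotent_genideal_eq_carrier_iff[OF a] a1 fstJ by simp
  have "idempotent_generated A (fst ` I)"
    using wvnr_ring.idempotent_generated_subideal[OF wvnr finitely_generated_fst_image[OF I]
        finitely_generated_fst_image[OF J] image_mono[OF IJ] fst_proper
        idempotent_generated_fst_image[OF gen]] .
  then obtain b where b: "idempotent_element A b" and fstI: "fst ` I = Idl\<^bsub>A\<^esub> {b}"
    by (auto simp: idempotent_generated_def)
  have bA: "b \<in> carrier A"
    using b by (simp add: idempotent_element_def)
  \<comment> \<open>Annihilation covers only idempotents other than 1. Were b = 1,
    \<open>fst\<close> I\<open>would be all of\<close>A\<open>inside the proper ideal\<close>fst
    \<open>J\<close>.\<close>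
  have "b \<noteq> \<one>\<^bsub>A\<^esub>"
  proof
    assume "b = \<one>\<^bsub>A\<^esub>"
    then have "carrier A \<subseteq> fst ` J"
      using image_mono[OF IJ, of fst] fstI R.genideal_one by simp
    moreover have "fst ` J \<subseteq> carrier A"
      using R.idempotent_element_absorbs(1)[OF a] fstJ by blast
    ultimately show False
      using fst_proper by blast
  qed
  then have "Idl\<^bsub>?T\<^esub> {(b, \<zero>\<^bsub>E\<^esub>)} = fst ` I \<times> {\<zero>\<^bsub>E\<^esub>}"
    unfolding fstI by (intro genideal_annihilating_idempotent[OF bA] ann[OF b])
  also have "\<dots> = I"
    using IJ Jprod by force
  finally show "idempotent_generated ?T I"
    using idempotent_element_trivial_extension_zero[OF b]
    unfolding idempotent_generated_def by blast
qed

end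

theorem theorem2p18:
  fixes A :: "('a, 'm) ring_scheme" and E :: "('a, 'b, 'n) module_scheme"
  assumes "cring A" and "\<one>\<^bsub>A\<^esub> \<noteq> \<zero>\<^bsub>A\<^esub>"
    and "module A E"
  shows "wvnr_ring (trivial_extension A E) \<longleftrightarrow>
    wvnr_ring A \<and>
    (\<forall>a. idempotent_element A a \<and> a \<noteq> \<one>\<^bsub>A\<^esub> \<longrightarrow>
      (\<forall>e \<in> carrier E. a \<odot>\<^bsub>E\<^esub> e = \<zero>\<^bsub>E\<^esub>))"
  using wvnr_ring_base[OF assms(3)] idempotent_annihilates_module[OF assms(3)]
    wvnr_ring_trivial_extension[OF assms(3)] by blast

end
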